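(* If $G$ is a graph with minimum degree $\delta \geq 5$, then $\operatorname{Maj}'(G) \leq 3$; that is, $G$ admits a strong majority edge colouring with $3$ colours.
   Context: Graphs are finite and simple. Edge colourings are arbitrary maps from the edge set to a set of colours (not necessarily proper, and not all colours need be used). Two distinct edges are adjacent if they share an endpoint; thus an edge $e=uv$ is adjacent to exactly $d(u)+d(v)-2$ edges, where $d(\cdot)$ denotes degree. A strong majority edge colouring of a graph $G$ is an edge colouring such that for every edge $e$ and every colour $\alpha$, at most half of the edges adjacent to $e$ receive colour $\alpha$. $\operatorname{Maj}'(G)$ denotes the least number of colours in a strong majority edge colouring of $G$. *)

theory Defs
  imports Main "HOL-Library.FuncSet" "HOL-Library.Extended_Nat"
begin

definition simple_graph :: "'a set \<Rightarrow> 'a set set \<Rightarrow> bool" where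
  "simple_graph V E \<longleftrightarrow> finite V \<and> (\<forall>e\<in>E. e \<subseteq> V \<and> card e = 2)"

definition degree :: "'a set set \<Rightarrow> 'a \<Rightarrow> nat" where
  "degree E v = card {e \<in> E. v \<in> e}"

text \<open>Valued in \<^typ>\<open>enat\<close> so that the graph without vertices needs no separate treatment:
  its minimum degree is the infimum of the empty set, i.e. infinity.\<close>

definition min_degree :: "'a set \<Rightarrow> 'a set set \<Rightarrow> enat" where
  "min_degree V E = (INF v\<in>V. enat (degree E v))"

definition adjacent_edges :: "'a set set \<Rightarrow> 'a set \<Rightarrow> 'a set set" where
  "adjacent_edges E e = {f \<in> E. f \<noteq> e \<and> f \<inter> e \<noteq> {}}"

definition strong_majority_edge_colouring ::
    "'a set set \<Rightarrow> 'c set \<Rightarrow> ('a set \<Rightarrow> 'c) \<Rightarrow> bool" where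
  "strong_majority_edge_colouring E C c \<longleftrightarrow>
     c \<in> E \<rightarrow> C \<and>
     (\<forall>e\<in>E. \<forall>\<alpha>\<in>C.
        2 * card {f \<in> adjacent_edges E e. c f = \<alpha>} \<le> card (adjacent_edges E e))"

text \<open>Some graphs (e.g. a path with two edges) have no strong majority edge colouring at all;
  the infimum in \<^typ>\<open>enat\<close> is then infinity, so a finite bound does entail
  the existence of a colouring.\<close>

definition Maj' :: "'a set set \<Rightarrow> enat" where
  "Maj' E = Inf {enat k |k. \<exists>c. strong_majority_edge_colouring E {..<k} c}"

end

theory Submission
  imports Defs
begin

text \<open>
  Orient \<open>G\<close> in a balanced way, regard it as a bipartite graph between tails and heads, split the
  fibres into groups of at most three edges and colour this bipartite graph of maximum degree three
  properly (Koenig). A vertex with \<open>p\<close> outgoing and \<open>q\<close> ingoing edges then sees each colour at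
  most \<open>\<lceil>p/3\<rceil> + \<lceil>q/3\<rceil>\<close> times, and at most \<open>(d - 1)/2\<close> times at every vertex suffices. This holds
  for every nearly balanced split of a degree \<open>d \<ge> 5\<close>, except that \<open>6\<close> must be split \<open>3 + 3\<close> and
  \<open>8\<close> must be split \<open>3 + 5\<close>.

  To obtain the split \<open>3 + 5\<close>, take a maximal set \<open>J\<close> of edges that avoids degree \<open>6\<close> and has at
  most one edge at each vertex of degree \<open>8\<close>, and reverse the edges of \<open>J\<close> in a suitable balanced
  orientation. A vertex of degree \<open>8\<close> missed by \<open>J\<close> sees a colour up to four times, but by
  maximality its neighbours have even degree and are not of this kind, so each sees a colour at
  most \<open>(d - 2)/2\<close> times, which makes up for it.
\<close>

section \<open>Bipartite multigraphs of maximum degree two\<close>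

text \<open>Supplies the induction step of \<open>two_colouring\<close>, separated so that it also
  serves, with \<open>l\<close> and \<open>r\<close> exchanged, for two edges in a common
  \<open>r\<close>-class. The hypothesis \<open>IH\<close> ranges over all \<open>r'\<close> because
  deleting \<open>e\<close> and \<open>f\<close> changes the \<open>r\<close>-classes, while
  \<open>l\<close> stays fixed.\<close>

lemma two_colouring_step:
  fixes l :: "'e \<Rightarrow> 'b" and r :: "'e \<Rightarrow> 'c"
  assumes fin: "finite E" and ef: "e \<in> E" "f \<in> E" "e \<noteq> f" "l e = l f"
    and l: "\<And>x. card {g \<in> E. l g = x} \<le> 2" and r: "\<And>x. card {g \<in> E. r g = x} \<le> 2"
    and IH: "\<And>r' :: 'e \<Rightarrow> 'c. (\<And>x. card {g \<in> E - {e, f}. r' g = x} \<le> 2) \<Longrightarrow>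
      \<exists>c :: 'e \<Rightarrow> bool. \<forall>x \<in> E - {e, f}. \<forall>y \<in> E - {e, f}.
        x \<noteq> y \<longrightarrow> l x = l y \<or> r' x = r' y \<longrightarrow> c x \<noteq> c y"
  shows "\<exists>c :: 'e \<Rightarrow> bool. \<forall>x \<in> E. \<forall>y \<in> E. x \<noteq> y \<longrightarrow> l x = l y \<or> r x = r y \<longrightarrow> c x \<noteq> c y"
proof -
  let ?E = "E - {e, f}"
  txt \<open>Since \<open>e\<close> and \<open>f\<close> get different colours, their other neighbours must differ as well:
    delete both edges and merge their \<open>r\<close>-classes.\<close>
  define r' where "r' g = (if r g = r e then r f else r g)" for g
  have three: False if "x \<in> E" "y \<in> E" "z \<in> E" "x \<noteq> y" "y \<noteq> z" "x \<noteq> z" "h x = h y" "h y = h z"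
    "card {g \<in> E. h g = h x} \<le> 2" for x y z and h :: "'e \<Rightarrow> 'd"
  proof -
    have "card {x, y, z} \<le> card {g \<in> E. h g = h x}"
      using fin that by (intro card_mono) auto
    then show False using that by simp
  qed
  have l_ef: "l g \<noteq> l e" "l g \<noteq> l f" if "g \<in> ?E" for g
    using three[of e f g l] that ef l[of "l e"] by auto
  have uniq: "g = h" if "g \<in> E" "h \<in> E" "r g = r a" "r h = r a" "a \<in> E" "g \<noteq> a" "h \<noteq> a" for g h a
    using three[of a g h r] that r[of "r a"] by auto
  have r': "card {g \<in> ?E. r' g = x} \<le> 2" for x
  proof (cases "x = r f")
    case False
    then have "{g \<in> ?E. r' g = x} \<subseteq> {g \<in> E. r g = x}"
      unfolding r'_def by auto
    then have "card {g \<in> ?E. r' g = x} \<le> card {g \<in> E. r g = x}"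
      using fin by (intro card_mono) auto
    then show ?thesis using r[of x] by linarith
  next
    case True
    \<comment> \<open>The two merged classes lose \<open>e\<close> and \<open>f\<close>
      respectively, so each contributes at most one element.\<close>
    have "{g \<in> ?E. r' g = x} \<subseteq> ({g \<in> E. r g = r e} - {e}) \<union> ({g \<in> E. r g = r f} - {f})"
      unfolding r'_def True by auto
    then have "card {g \<in> ?E. r' g = x} \<le> card (({g \<in> E. r g = r e} - {e}) \<union> ({g \<in> E. r g = r f} - {f}))"
      using fin by (intro card_mono) auto
    also have "\<dots> \<le> card ({g \<in> E. r g = r e} - {e}) + card ({g \<in> E. r g = r f} - {f})"
      by (rule card_Un_le)
    also have "\<dots> \<le> 1 + 1"
      using ef r[of "r e"] r[of "r f"] by (intro add_mono) (simp_all add: card_Diff_singleton)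
    finally show ?thesis by simp
  qed
  obtain c :: "'e \<Rightarrow> bool" where
    "\<forall>x \<in> ?E. \<forall>y \<in> ?E. x \<noteq> y \<longrightarrow> l x = l y \<or> r' x = r' y \<longrightarrow> c x \<noteq> c y"
    using IH[of r', OF r'] by (rule exE)
  then have c: "c x \<noteq> c y" if "x \<in> ?E" "y \<in> ?E" "x \<noteq> y" "l x = l y \<or> r' x = r' y" for x y
    using that by blast
  \<comment> \<open>\<open>e\<close> will get \<open>b\<close> and \<open>f\<close> will get
    \<open>\<not> b\<close>. Each has at most one remaining \<open>r\<close>-neighbour. If both
    neighbours \<open>g\<close> and \<open>h\<close> exist, merging has forced
    \<open>c g \<noteq> c h\<close>, so \<open>\<not> c g = c h\<close> is a value of
    \<open>b\<close> that suits both ends.\<close>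
  obtain b where be: "\<And>g. g \<in> ?E \<Longrightarrow> r g = r e \<Longrightarrow> c g \<noteq> b"
    and bf: "\<And>h. h \<in> ?E \<Longrightarrow> r h = r f \<Longrightarrow> c h = b"
  proof (cases "\<exists>g \<in> ?E. r g = r e")
    case True
    then obtain g where g: "g \<in> ?E" "r g = r e" by blast
    have "c h = (\<not> c g)" if h: "h \<in> ?E" "r h = r f" for h
    proof (cases "h = g")
      case True
      then show ?thesis using three[of e f g r] g h ef r[of "r e"] by auto
    next
      case False
      then show ?thesis using c[of h g] g h by (auto simp: r'_def)
    qed
    moreover have "c g' = c g" if "g' \<in> ?E" "r g' = r e" for g'
      using uniq[of g g' e] g that ef by auto
    ultimately show ?thesis using that[of "\<not> c g"] by auto
  next
    case False
    show ?thesis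
    proof (cases "\<exists>h \<in> ?E. r h = r f")
      case True
      then obtain h where h: "h \<in> ?E" "r h = r f" by blast
      have "c h' = c h" if "h' \<in> ?E" "r h' = r f" for h'
        using uniq[of h h' f] h that ef by auto
      then show ?thesis using that[of "c h"] False by auto
    next
      case nex: False
      then show ?thesis using that[of True] False by auto
    qed
  qed
  define c' where "c' = c(e := b, f := \<not> b)"
  have "c' x \<noteq> c' y" if xy: "x \<in> E" "y \<in> E" "x \<noteq> y" "l x = l y \<or> r x = r y" for x y
  proof -
    consider "x \<in> ?E" "y \<in> ?E" | "x \<in> ?E" "y = e" | "x \<in> ?E" "y = f"
      | "y \<in> ?E" "x = e" | "y \<in> ?E" "x = f" | "x = e" "y = f" | "x = f" "y = e"
      using xy by blast
    then show ?thesis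
    proof cases
      case 1
      then have "l x = l y \<or> r' x = r' y" using xy by (auto simp: r'_def)
      then show ?thesis using c[of x y] 1 xy by (auto simp: c'_def)
    next
      case 2
      then show ?thesis using l_ef(1)[of x] be[of x] xy ef by (auto simp: c'_def)
    next
      case 3
      then show ?thesis using l_ef(2)[of x] bf[of x] xy ef by (auto simp: c'_def)
    next
      case 4
      then show ?thesis using l_ef(1)[of y] be[of y] xy ef by (auto simp: c'_def)
    next
      case 5
      then show ?thesis using l_ef(2)[of y] bf[of y] xy ef by (auto simp: c'_def)
    qed (use ef in \<open>auto simp: c'_def\<close>)
  qed
  then show ?thesis by blast
qed

text \<open>Elements of \<open>E\<close> are edges of a bipartite multigraph whose vertices are the
  values of \<open>l\<close> and of \<open>r\<close>. With degrees at most two it consists of paths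
  and even cycles, whose edges can be coloured alternately. Induction on the number of edges avoids
  walks altogether: if neither \<open>l\<close> nor \<open>r\<close> identifies two edges there is
  no constraint, and otherwise two adjacent edges are removed.\<close>

lemma two_colouring:
  fixes l :: "'e \<Rightarrow> 'b" and r :: "'e \<Rightarrow> 'c"
  assumes "finite E"
    and "\<And>x. card {e \<in> E. l e = x} \<le> 2" and "\<And>x. card {e \<in> E. r e = x} \<le> 2"
  shows "\<exists>c :: 'e \<Rightarrow> bool. \<forall>x \<in> E. \<forall>y \<in> E. x \<noteq> y \<longrightarrow> l x = l y \<or> r x = r y \<longrightarrow> c x \<noteq> c y"
  using assms
proof (induction "card E" arbitrary: E l r rule: less_induct)
  case less
  have sub: "card {g \<in> E - X. h g = x} \<le> 2" if "\<And>x. card {g \<in> E. h g = x} \<le> 2"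
    for X x and h :: "'e \<Rightarrow> 'd"
  proof -
    have "card {g \<in> E - X. h g = x} \<le> card {g \<in> E. h g = x}"
      using less.prems(1) by (intro card_mono) auto
    then show ?thesis using that[of x] by simp
  qed
  have smaller: "card (E - {e, f}) < card E" if "e \<in> E" "f \<in> E" for e f
    using that less.prems(1) by (intro psubset_card_mono) auto
  show ?case
  proof (cases "inj_on l E \<and> inj_on r E")
    case True
    then show ?thesis by (auto simp: inj_on_def)
  next
    case False
    then consider e f where "e \<in> E" "f \<in> E" "e \<noteq> f" "l e = l f"
      | e f where "e \<in> E" "f \<in> E" "e \<noteq> f" "r e = r f"
      by (auto simp: inj_on_def)
    then show ?thesis
    proof cases
      case (1 e f)
      show ?thesis
      proof (rule two_colouring_step[OF less.prems(1) 1 less.prems(2,3)])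
        fix r' :: "'e \<Rightarrow> 'c" assume r': "\<And>x. card {g \<in> E - {e, f}. r' g = x} \<le> 2"
        show "\<exists>c :: 'e \<Rightarrow> bool. \<forall>x \<in> E - {e, f}. \<forall>y \<in> E - {e, f}.
          x \<noteq> y \<longrightarrow> l x = l y \<or> r' x = r' y \<longrightarrow> c x \<noteq> c y"
          using less.hyps[of "E - {e, f}" l r', OF smaller[OF 1(1,2)] finite_Diff[OF less.prems(1)]
              sub[OF less.prems(2)] r']
          by blast
      qed
    next
      case (2 e f)
      have "\<exists>c :: 'e \<Rightarrow> bool. \<forall>x \<in> E. \<forall>y \<in> E. x \<noteq> y \<longrightarrow> r x = r y \<or> l x = l y \<longrightarrow> c x \<noteq> c y"
      proof (rule two_colouring_step[OF less.prems(1) 2 less.prems(3,2)])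
        fix l' :: "'e \<Rightarrow> 'b" assume l': "\<And>x. card {g \<in> E - {e, f}. l' g = x} \<le> 2"
        show "\<exists>c :: 'e \<Rightarrow> bool. \<forall>x \<in> E - {e, f}. \<forall>y \<in> E - {e, f}.
          x \<noteq> y \<longrightarrow> r x = r y \<or> l' x = l' y \<longrightarrow> c x \<noteq> c y"
          using less.hyps[of "E - {e, f}" l' r, OF smaller[OF 2(1,2)] finite_Diff[OF less.prems(1)]
              l' sub[OF less.prems(3)]]
          by blast
      qed
      then show ?thesis by blast
    qed
  qed
qed

section \<open>Koenig's edge colouring theorem\<close>

text \<open>The bound \<open>k\<close> counts \<open>e\<close> itself, so fewer than
  \<open>k\<close> other edges lie in its class and some colour is free there.\<close>

lemma exists_missing_colour:
  fixes c :: "'e \<Rightarrow> nat"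
  assumes "finite F" "e \<notin> F" "card {f \<in> insert e F. l f = l e} \<le> k"
  obtains a where "a < k" "\<And>f. f \<in> F \<Longrightarrow> l f = l e \<Longrightarrow> c f \<noteq> a"
proof -
  let ?A = "{f \<in> F. l f = l e}"
  have "{f \<in> insert e F. l f = l e} = insert e ?A" by auto
  then have "card ?A < k" using assms by simp
  then have "card (c ` ?A) < card {..<k}"
    using card_image_le[of ?A c] assms(1) by simp
  then have "\<not> {..<k} \<subseteq> c ` ?A"
    using card_mono[of "c ` ?A" "{..<k}"] assms(1) by auto
  then show ?thesis using that by auto
qed

text \<open>This is Koenig's theorem for bipartite multigraphs, parallel edges being elements that
  agree under both \<open>l\<close> and \<open>r\<close>. Edges are inserted one at a time. A new
  edge has a free colour \<open>a\<close> at its \<open>l\<close>-end and a free colour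
  \<open>b\<close> at its \<open>r\<close>-end, and only \<open>a \<noteq> b\<close> calls for
  recolouring.\<close>

lemma konig_edge_colouring:
  fixes l :: "'e \<Rightarrow> 'b" and r :: "'e \<Rightarrow> 'c"
  assumes "finite E"
    and "\<And>x. card {e \<in> E. l e = x} \<le> k" and "\<And>x. card {e \<in> E. r e = x} \<le> k"
  shows "\<exists>c \<in> E \<rightarrow> {..<k}. \<forall>x \<in> E. \<forall>y \<in> E. x \<noteq> y \<longrightarrow> l x = l y \<or> r x = r y \<longrightarrow> c x \<noteq> c y"
  using assms
proof (induction E rule: finite_induct)
  case empty
  then show ?case by auto
next
  case (insert e F)
  have "card {g \<in> F. h g = x} \<le> card {g \<in> insert e F. h g = x}" for x and h :: "'e \<Rightarrow> 'd"
    using insert.hyps by (intro card_mono) auto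
  note sub = order_trans[OF this]
  have "\<exists>c \<in> F \<rightarrow> {..<k}. \<forall>x \<in> F. \<forall>y \<in> F. x \<noteq> y \<longrightarrow> l x = l y \<or> r x = r y \<longrightarrow> c x \<noteq> c y"
    by (rule insert.IH) (rule sub[OF insert.prems(1)] sub[OF insert.prems(2)])+
  then obtain c where cF: "c \<in> F \<rightarrow> {..<k}"
    and c: "\<And>x y. x \<in> F \<Longrightarrow> y \<in> F \<Longrightarrow> x \<noteq> y \<Longrightarrow> l x = l y \<or> r x = r y \<Longrightarrow> c x \<noteq> c y"
    by blast
  obtain a where a: "a < k" "\<And>f. f \<in> F \<Longrightarrow> l f = l e \<Longrightarrow> c f \<noteq> a"
    using exists_missing_colour[OF insert.hyps insert.prems(1), where c = c] by blast
  obtain b where b: "b < k" "\<And>f. f \<in> F \<Longrightarrow> r f = r e \<Longrightarrow> c f \<noteq> b"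
    using exists_missing_colour[OF insert.hyps insert.prems(2), where c = c] by blast
  show ?case
  proof (cases "a = b")
    case True
    have "(c(e := a)) x \<noteq> (c(e := a)) y"
      if "x \<in> insert e F" "y \<in> insert e F" "x \<noteq> y" "l x = l y \<or> r x = r y" for x y
      using a(2)[of x] a(2)[of y] b(2)[of x] b(2)[of y] c[of x y] that insert.hyps True by auto
    moreover have "c(e := a) \<in> insert e F \<rightarrow> {..<k}"
      using a cF by (auto simp: Pi_iff)
    ultimately show ?thesis by blast
  next
    case False
    txt \<open>Instead of swapping along a Kempe chain, recolour all edges coloured \<open>a\<close> or \<open>b\<close>,
      together with \<open>e\<close>.\<close>
    define W where "W = insert e {f \<in> F. c f = a \<or> c f = b}"
    \<comment> \<open>Giving \<open>e\<close> a colour \<open>m\<close> that is free in its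
      \<open>h\<close>-class makes the colouring injective on every \<open>h\<close>-class of
      \<open>W\<close>, with values in \<open>{a, b}\<close>. The choice of \<open>m\<close> differs
      between \<open>l\<close> and \<open>r\<close> and serves this count only.\<close>
    have fibre: "card {f \<in> W. h f = x} \<le> 2"
      if "m \<in> {a, b}" "\<And>f. f \<in> F \<Longrightarrow> h f = h e \<Longrightarrow> c f \<noteq> m"
        "\<And>f g. f \<in> F \<Longrightarrow> g \<in> F \<Longrightarrow> f \<noteq> g \<Longrightarrow> h f = h g \<Longrightarrow> c f \<noteq> c g"
      for x m and h :: "'e \<Rightarrow> 'd"
    proof -
      have "card {f \<in> W. h f = x} \<le> card {a, b}"
      proof (rule card_inj_on_le)
        show "inj_on (c(e := m)) {f \<in> W. h f = x}"
        proof (rule inj_onI, rule ccontr)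
          fix f g assume fg: "f \<in> {f \<in> W. h f = x}" "g \<in> {f \<in> W. h f = x}"
            "(c(e := m)) f = (c(e := m)) g" "f \<noteq> g"
          then show False
            using that(2)[of f] that(2)[of g] that(3)[of f g] insert.hyps
            by (auto simp: W_def split: if_splits)
        qed
      qed (use that in \<open>auto simp: W_def\<close>)
      then show ?thesis using False by simp
    qed
    have "finite W" using insert.hyps by (simp add: W_def)
    moreover have "card {f \<in> W. l f = x} \<le> 2" for x
      by (rule fibre[of a l]) (use a c in auto)
    moreover have "card {f \<in> W. r f = x} \<le> 2" for x
      by (rule fibre[of b r]) (use b c in auto)
    ultimately have "\<exists>d :: 'e \<Rightarrow> bool. \<forall>x \<in> W. \<forall>y \<in> W. x \<noteq> y \<longrightarrow>
        l x = l y \<or> r x = r y \<longrightarrow> d x \<noteq> d y"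
      by (rule two_colouring)
    then obtain d :: "'e \<Rightarrow> bool" where
      "\<forall>x \<in> W. \<forall>y \<in> W. x \<noteq> y \<longrightarrow> l x = l y \<or> r x = r y \<longrightarrow> d x \<noteq> d y"
      by (rule exE)
    then have d: "d x \<noteq> d y" if "x \<in> W" "y \<in> W" "x \<noteq> y" "l x = l y \<or> r x = r y" for x y
      using that by blast
    \<comment> \<open>Edges outside \<open>W\<close> have colours other than \<open>a\<close> and
      \<open>b\<close>, so they cannot clash with recoloured ones.\<close>
    define c' where "c' f = (if f \<in> W then if d f then a else b else c f)" for f
    have "c' x \<noteq> c' y" if xy: "x \<in> insert e F" "y \<in> insert e F" "x \<noteq> y" "l x = l y \<or> r x = r y" for x y
    proof -
      have out: "z \<in> F" "c z \<noteq> a" "c z \<noteq> b" if "z \<in> insert e F" "z \<notin> W" for z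
        using that by (auto simp: W_def)
      show ?thesis
        using d[of x y] c[of x y] out[of x] out[of y] xy False
        unfolding c'_def by (cases "x \<in> W"; cases "y \<in> W") auto
    qed
    moreover have "c' \<in> insert e F \<rightarrow> {..<k}"
      using a b cF by (auto simp: c'_def W_def Pi_iff)
    ultimately show ?thesis by blast
  qed
qed

section \<open>Equitable colourings with respect to two partitions\<close>

text \<open>Number the elements of each fibre from 0 and divide by \<open>k\<close>: the quotients
  are labels of blocks of size at most \<open>k\<close>. A fibre of size \<open>n\<close> has
  \<open>(n + k - 1) div k\<close> blocks, which is n/k rounded up.\<close>

lemma split_fibres:
  fixes f :: "'e \<Rightarrow> 'b"
  assumes "finite E" "k > 0"
  obtains i :: "'e \<Rightarrow> nat" where "\<And>x n. card {e \<in> E. f e = x \<and> i e = n} \<le> k"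
    and "\<And>e. e \<in> E \<Longrightarrow> i e < (card {g \<in> E. f g = f e} + k - 1) div k"
proof -
  have "\<exists>h. \<forall>x. bij_betw (h x) {e \<in> E. f e = x} {0..<card {e \<in> E. f e = x}}"
    using assms(1) by (intro choice allI ex_bij_betw_finite_nat) auto
  then obtain h where h: "\<And>x. bij_betw (h x) {e \<in> E. f e = x} {0..<card {e \<in> E. f e = x}}"
    by blast
  show ?thesis
  proof (rule that[of "\<lambda>e. h (f e) e div k"])
    fix x n
    have "card {e \<in> E. f e = x \<and> h (f e) e div k = n} \<le> card {n * k..<n * k + k}"
    proof (rule card_inj_on_le)
      show "inj_on (h x) {e \<in> E. f e = x \<and> h (f e) e div k = n}"
        using bij_betw_imp_inj_on[OF h[of x]] by (rule inj_on_subset) auto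
      show "h x ` {e \<in> E. f e = x \<and> h (f e) e div k = n} \<subseteq> {n * k..<n * k + k}"
      proof -
        have "m div k * k \<le> m" "m < m div k * k + k" for m
          using assms(2) div_mult_mod_eq[of m k] mod_less_divisor[of k m] by linarith+
        then show ?thesis by auto
      qed
    qed simp
    then show "card {e \<in> E. f e = x \<and> h (f e) e div k = n} \<le> k" by simp
  next
    fix e assume "e \<in> E"
    then have "h (f e) e < card {g \<in> E. f g = f e}"
      using bij_betwE[OF h[of "f e"]] by auto
    \<comment> \<open>Adding \<open>k\<close> raises the quotient by exactly one, which turns the
      strict bound on the position into a strict bound on the block label.\<close>
    then have "h (f e) e + k \<le> card {g \<in> E. f g = f e} + k - 1" by simp
    then have "(h (f e) e + k) div k \<le> (card {g \<in> E. f g = f e} + k - 1) div k"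
      by (rule div_le_mono)
    then show "h (f e) e div k < (card {g \<in> E. f g = f e} + k - 1) div k"
      using assms(2) by simp
  qed
qed

text \<open>Taking the blocks of \<open>split_fibres\<close> as vertices gives a bipartite
  multigraph of maximum degree at most \<open>k\<close>. A proper colouring with \<open>k\<close>
  colours uses each colour at most once per block, hence in a fibre at most as often as there are
  blocks.\<close>

lemma equitable_colouring:
  fixes f :: "'e \<Rightarrow> 'b" and g :: "'e \<Rightarrow> 'c"
  assumes "finite E" "k > 0"
  obtains c :: "'e \<Rightarrow> nat" where "c \<in> E \<rightarrow> {..<k}"
    and "\<And>x \<alpha>. card {e \<in> E. f e = x \<and> c e = \<alpha>} \<le> (card {e \<in> E. f e = x} + k - 1) div k"
    and "\<And>x \<alpha>. card {e \<in> E. g e = x \<and> c e = \<alpha>} \<le> (card {e \<in> E. g e = x} + k - 1) div k"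
proof -
  obtain i where i: "\<And>x n. card {e \<in> E. f e = x \<and> i e = n} \<le> k"
    "\<And>e. e \<in> E \<Longrightarrow> i e < (card {g \<in> E. f g = f e} + k - 1) div k"
    using split_fibres[OF assms, where f = f] by blast
  obtain j where j: "\<And>x n. card {e \<in> E. g e = x \<and> j e = n} \<le> k"
    "\<And>e. e \<in> E \<Longrightarrow> j e < (card {h \<in> E. g h = g e} + k - 1) div k"
    using split_fibres[OF assms, where f = g] by blast
  have "\<exists>c \<in> E \<rightarrow> {..<k}. \<forall>x \<in> E. \<forall>y \<in> E. x \<noteq> y \<longrightarrow>
      (f x, i x) = (f y, i y) \<or> (g x, j x) = (g y, j y) \<longrightarrow> c x \<noteq> c y"
  proof (rule konig_edge_colouring[OF assms(1)])
    show "card {e \<in> E. (f e, i e) = p} \<le> k" for p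
      using i(1)[of "fst p" "snd p"] by (cases p) simp
    show "card {e \<in> E. (g e, j e) = p} \<le> k" for p
      using j(1)[of "fst p" "snd p"] by (cases p) simp
  qed
  then obtain c where cE: "c \<in> E \<rightarrow> {..<k}" and "\<forall>x \<in> E. \<forall>y \<in> E. x \<noteq> y \<longrightarrow>
      (f x, i x) = (f y, i y) \<or> (g x, j x) = (g y, j y) \<longrightarrow> c x \<noteq> c y"
    by (rule bexE)
  then have c: "c x \<noteq> c y" if "x \<in> E" "y \<in> E" "x \<noteq> y"
      "f x = f y \<and> i x = i y \<or> g x = g y \<and> j x = j y" for x y
    using that by auto
  have inj_bound: "card {e \<in> E. h e = x \<and> c e = \<alpha>} \<le> (card {e \<in> E. h e = x} + k - 1) div k"
    if "\<And>e. e \<in> E \<Longrightarrow> m e < (card {g \<in> E. h g = h e} + k - 1) div k"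
      "\<And>x y. x \<in> E \<Longrightarrow> y \<in> E \<Longrightarrow> x \<noteq> y \<Longrightarrow> h x = h y \<and> m x = m y \<Longrightarrow> c x \<noteq> c y"
    for m and h :: "'e \<Rightarrow> 'd" and x \<alpha>
  proof -
    have "card {e \<in> E. h e = x \<and> c e = \<alpha>} \<le> card {..<(card {e \<in> E. h e = x} + k - 1) div k}"
    proof (rule card_inj_on_le)
      show "inj_on m {e \<in> E. h e = x \<and> c e = \<alpha>}"
      proof (rule inj_onI, rule ccontr)
        fix x1 x2 assume x12: "x1 \<in> {e \<in> E. h e = x \<and> c e = \<alpha>}" "x2 \<in> {e \<in> E. h e = x \<and> c e = \<alpha>}"
          "m x1 = m x2" "x1 \<noteq> x2"
        then have "c x1 \<noteq> c x2" by (intro that(2)) simp_all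
        then show False using x12 by simp
      qed
    qed (use that(1) in auto)
    then show ?thesis by simp
  qed
  show ?thesis
  proof (rule that[OF cE])
    show "card {e \<in> E. f e = x \<and> c e = \<alpha>} \<le> (card {e \<in> E. f e = x} + k - 1) div k" for x \<alpha>
      by (rule inj_bound[of i f, OF i(2) c[OF _ _ _ disjI1]])
    show "card {e \<in> E. g e = x \<and> c e = \<alpha>} \<le> (card {e \<in> E. g e = x} + k - 1) div k" for x \<alpha>
      by (rule inj_bound[of j g, OF j(2) c[OF _ _ _ disjI2]])
  qed
qed

section \<open>Balanced orientations with prescribed exceptions\<close>

text \<open>The two rounded thirds add up to at most (d + 4)/3, and 2(d + 4)/3 \<le> d - 1 once d
  \<ge> 11; the six smaller degrees are checked one by one. The splits 2 + 4 of 6 and 4 + 4 of 8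
  exceed the bound by one, hence the last two hypotheses.\<close>

lemma balanced_split_bound:
  fixes p q d :: nat
  assumes "p + q = d" "d \<ge> 5" "p \<le> (d + 2) div 2" "q \<le> (d + 2) div 2"
    and "d = 6 \<Longrightarrow> p = 3" "d = 8 \<Longrightarrow> p = 3 \<or> p = 5"
  shows "2 * ((p + 2) div 3 + (q + 2) div 3) \<le> d - 1"
proof (cases "d \<ge> 11")
  case True
  define P Q where "P = (p + 2) div 3" and "Q = (q + 2) div 3"
  have "3 * P \<le> p + 2" "3 * Q \<le> q + 2" by (simp_all add: P_def Q_def)
  then have "2 * (P + Q) \<le> d - 1" using True assms(1) by simp
  then show ?thesis by (simp add: P_def Q_def)
next
  case False
  have q: "q = d - p" using assms(1) by simp
  consider "d = 5" | "d = 6" | "d = 7" | "d = 8" | "d = 9" | "d = 10"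
    using False assms(2) by linarith
  then show ?thesis
  proof cases
    case 1
    then have "p = 2 \<or> p = 3" using assms by auto
    then show ?thesis using 1 q by auto
  next
    case 2
    then show ?thesis using assms q by auto
  next
    case 3
    then have "p = 3 \<or> p = 4" using assms by auto
    then show ?thesis using 3 q by auto
  next
    case 4
    then show ?thesis using assms q by auto
  next
    case 5
    then have "p = 4 \<or> p = 5" using assms by auto
    then show ?thesis using 5 q by auto
  next
    case 6
    then have "p = 4 \<or> p = 5 \<or> p = 6" using assms by auto
    then show ?thesis using 6 q by auto
  qed
qed

text \<open>Colour the darts, pairs of an edge and one of its ends, equitably with two colours. With
  respect to edges this gives the two darts of an edge different colours, that is, an orientation;
  with respect to vertices it balances outgoing and ingoing edges. The exceptional value 8 is 2 * (2
  + 2), from the split 4 + 4 at a vertex of degree 8 missed by \<open>J\<close>.\<close>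

lemma balanced_orientation:
  fixes E J :: "'a set set"
  assumes fin: "finite E" and edge: "\<And>e. e \<in> E \<Longrightarrow> card e = 2" and JE: "J \<subseteq> E"
    and J6: "\<And>v. degree E v = 6 \<Longrightarrow> degree J v = 0"
    and J8: "\<And>v. degree E v = 8 \<Longrightarrow> degree J v \<le> 1"
  obtains out :: "'a set \<Rightarrow> 'a \<Rightarrow> bool"
  where "\<And>e u v. e \<in> E \<Longrightarrow> u \<in> e \<Longrightarrow> v \<in> e \<Longrightarrow> u \<noteq> v \<Longrightarrow> out e u \<noteq> out e v"
    and "\<And>v. degree E v \<ge> 5 \<Longrightarrow>
      2 * ((card {e \<in> E. v \<in> e \<and> out e v} + 2) div 3 + (card {e \<in> E. v \<in> e \<and> \<not> out e v} + 2) div 3)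
        \<le> (if degree E v = 8 \<and> degree J v = 0 then 8 else degree E v - 1)"
proof -
  define N where "N v = {e \<in> E. v \<in> e}" for v
  define Jv where "Jv v = {e \<in> J. v \<in> e}" for v
  have finN [simp]: "finite (N v)" for v using fin by (simp add: N_def)
  have JN: "Jv v \<subseteq> N v" for v using JE by (auto simp: N_def Jv_def)
  have finJ [simp]: "finite (Jv v)" for v using JN finN by (rule finite_subset)
  have degE: "degree E v = card (N v)" and degJ: "degree J v = card (Jv v)" for v
    by (simp_all add: degree_def N_def Jv_def)
  txt \<open>The darts at \<open>v\<close> are balanced within \<open>S v\<close> and within its complement. When \<open>S v\<close> pairs the
    only \<open>J\<close>-edge at a vertex of degree 8 with another edge, reversing \<open>J\<close> makes both
    point the same way.\<close>
  define good where "good v S \<longleftrightarrow> S \<subseteq> N v \<and>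
    (if degree E v = 8 \<and> degree J v = 1 then card S = 2 \<and> Jv v \<subseteq> S else S = Jv v)" for v S
  have ex: "\<exists>S. good v S" for v
  proof (cases "degree E v = 8 \<and> degree J v = 1")
    case True
    then obtain a where a: "Jv v = {a}" by (auto simp: degJ card_1_singleton_iff)
    have "card (N v - {a}) \<noteq> 0" using True a JN[of v] by (simp add: degE)
    then have "N v - {a} \<noteq> {}" by (metis card.empty)
    then obtain q where "q \<in> N v" "q \<noteq> a" by auto
    moreover have "a \<in> N v" using a JN[of v] by simp
    ultimately have "good v {a, q}" using True a by (simp add: good_def)
    then show ?thesis by (rule exI)
  next
    case False
    then show ?thesis using JN by (auto simp: good_def)
  qed
  define S where "S v = (SOME S. good v S)" for v
  have good: "good v (S v)" for v
    unfolding S_def by (rule someI_ex) (rule ex)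
  have SN: "S v \<subseteq> N v" for v using good[of v] by (simp add: good_def)
  have S: "if degree E v = 8 \<and> degree J v = 1 then card (S v) = 2 \<and> Jv v \<subseteq> S v else S v = Jv v" for v
    using good[of v] unfolding good_def by (rule conjunct2)
  have "finite e" if "e \<in> E" for e using edge[OF that] by (simp add: card_ge_0_finite)
  then have finD: "finite (Sigma E (\<lambda>e. e))" using fin by (intro finite_SigmaI) auto
  obtain c :: "'a set \<times> 'a \<Rightarrow> nat" where cD: "c \<in> Sigma E (\<lambda>e. e) \<rightarrow> {..<2}"
    and c_edge: "\<And>e \<alpha>. card {p \<in> Sigma E (\<lambda>e. e). fst p = e \<and> c p = \<alpha>}
      \<le> (card {p \<in> Sigma E (\<lambda>e. e). fst p = e} + 2 - 1) div 2"
    and c_vertex: "\<And>x \<alpha>. card {p \<in> Sigma E (\<lambda>e. e). (snd p, fst p \<in> S (snd p)) = x \<and> c p = \<alpha>}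
      \<le> (card {p \<in> Sigma E (\<lambda>e. e). (snd p, fst p \<in> S (snd p)) = x} + 2 - 1) div 2"
    by (rule equitable_colouring[OF finD, of 2 fst "\<lambda>p. (snd p, fst p \<in> S (snd p))"]) simp_all
  \<comment> \<open>Colour 0 means outgoing, except that edges of \<open>J\<close> are reversed. The
    reversal affects both ends of an edge, so the result is again an orientation.\<close>
  define out where "out e v = ((c (e, v) = 0) \<noteq> (e \<in> J))" for e v
  show ?thesis
  proof (rule that[of out])
    fix e u v assume e: "e \<in> E" "u \<in> e" "v \<in> e" "u \<noteq> v"
    have "{p \<in> Sigma E (\<lambda>e. e). fst p = e} = Pair e ` e" using e by auto
    then have "card {p \<in> Sigma E (\<lambda>e. e). fst p = e} = 2"
      using edge[OF e(1)] by (simp add: card_image inj_on_def)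
    then have le: "card {p \<in> Sigma E (\<lambda>e. e). fst p = e \<and> c p = c (e, u)} \<le> 1"
      using c_edge[of e "c (e, u)"] by simp
    have "c (e, u) \<noteq> c (e, v)"
    proof
      assume "c (e, u) = c (e, v)"
      then have "card {(e, u), (e, v)} \<le> card {p \<in> Sigma E (\<lambda>e. e). fst p = e \<and> c p = c (e, u)}"
        using e finD by (intro card_mono) auto
      then show False using le e by simp
    qed
    moreover have "c (e, u) < 2" "c (e, v) < 2" using e cD by (auto simp: Pi_iff)
    ultimately have "(c (e, u) = 0) \<noteq> (c (e, v) = 0)" by linarith
    then show "out e u \<noteq> out e v" by (auto simp: out_def)
  next
    fix v assume d5: "degree E v \<ge> 5"
    define A B where "A = S v" and "B = N v - S v"
    have fAB [simp]: "finite A" "finite B" using SN[of v] by (auto simp: A_def B_def intro: finite_subset)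
    have AB: "N v = A \<union> B" "A \<inter> B = {}" using SN[of v] by (auto simp: A_def B_def)
    have half: "card {e \<in> X. c (e, v) = \<alpha>} \<le> (card X + 1) div 2"
      if "X = {e \<in> N v. (e \<in> S v) = b}" for X b \<alpha>
    proof -
      have "{p \<in> Sigma E (\<lambda>e. e). (snd p, fst p \<in> S (snd p)) = (v, b)} = (\<lambda>e. (e, v)) ` X"
        using that by (auto simp: N_def)
      moreover have "{p \<in> Sigma E (\<lambda>e. e). (snd p, fst p \<in> S (snd p)) = (v, b) \<and> c p = \<alpha>}
          = (\<lambda>e. (e, v)) ` {e \<in> X. c (e, v) = \<alpha>}"
        using that by (auto simp: N_def)
      ultimately show ?thesis
        using c_vertex[of "(v, b)" \<alpha>] by (simp add: card_image inj_on_def)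
    qed
    have one: "{e \<in> X. c (e, v) \<noteq> 0} = {e \<in> X. c (e, v) = 1}" if "X \<subseteq> N v" for X
    proof -
      have "c (e, v) < 2" if "e \<in> X" for e
        using that \<open>X \<subseteq> N v\<close> cD by (auto simp: N_def Pi_iff)
      then have "c (e, v) \<noteq> 0 \<longleftrightarrow> c (e, v) = 1" if "e \<in> X" for e
        using that by fastforce
      then show ?thesis by auto
    qed
    define a0 a1 b0 b1 where "a0 = card {e \<in> A. c (e, v) = 0}" and "a1 = card {e \<in> A. c (e, v) \<noteq> 0}"
      and "b0 = card {e \<in> B. c (e, v) = 0}" and "b1 = card {e \<in> B. c (e, v) \<noteq> 0}"
    have A: "A = {e \<in> N v. (e \<in> S v) = True}" and B: "B = {e \<in> N v. (e \<in> S v) = False}"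
      using SN[of v] by (auto simp: A_def B_def)
    have "A \<subseteq> N v" "B \<subseteq> N v" using AB by auto
    note ones = one[OF this(1)] one[OF this(2)]
    have a: "a0 \<le> (card A + 1) div 2" "a1 \<le> (card A + 1) div 2"
      unfolding a0_def a1_def ones by (rule half[OF A])+
    have b: "b0 \<le> (card B + 1) div 2" "b1 \<le> (card B + 1) div 2"
      unfolding b0_def b1_def ones by (rule half[OF B])+
    have split: "card {e \<in> X. Q e} + card {e \<in> X. \<not> Q e} = card X" if "finite X"
      for X :: "'a set set" and Q
    proof -
      have "X = {e \<in> X. Q e} \<union> {e \<in> X. \<not> Q e}" by blast
      moreover have "card ({e \<in> X. Q e} \<union> {e \<in> X. \<not> Q e}) = card {e \<in> X. Q e} + card {e \<in> X. \<not> Q e}"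
        using that by (intro card_Un_disjoint) auto
      ultimately show ?thesis by presburger
    qed
    have sums: "a0 + a1 = card A" "b0 + b1 = card B"
      unfolding a0_def a1_def b0_def b1_def by (rule split, simp)+
    have dsum: "card A + card B = degree E v"
      using AB by (simp add: degE card_Un_disjoint)
    define p q where "p = card {e \<in> E. v \<in> e \<and> out e v}" and "q = card {e \<in> E. v \<in> e \<and> \<not> out e v}"
    have pq: "p + q = degree E v"
      using split[OF finN, of v "\<lambda>e. out e v"] by (simp add: p_def q_def degE N_def)
    have cardAB: "card {e \<in> N v. Q e} = card {e \<in> A. Q e} + card {e \<in> B. Q e}" for Q
    proof -
      have "{e \<in> N v. Q e} = {e \<in> A. Q e} \<union> {e \<in> B. Q e}" using AB by auto
      then show ?thesis using AB by (simp add: card_Un_disjoint disjoint_iff)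
    qed
    have p: "p = card {e \<in> A. out e v} + card {e \<in> B. out e v}"
      using cardAB[of "\<lambda>e. out e v"] by (simp add: p_def N_def)
    \<comment> \<open>All \<open>J\<close>-edges at \<open>v\<close> lie in \<open>S v\<close>, so
      on \<open>B\<close> outgoing still means colour 0.\<close>
    have BJ: "e \<notin> J" if "e \<in> B" for e
      using that S[of v] by (auto simp: B_def N_def Jv_def split: if_splits)
    have outB: "card {e \<in> B. out e v} = b0"
      unfolding b0_def out_def using BJ by (intro arg_cong[where f = card]) auto
    have "2 * ((p + 2) div 3 + (q + 2) div 3)
        \<le> (if degree E v = 8 \<and> degree J v = 0 then 8 else degree E v - 1)"
    proof (cases "degree E v = 8 \<and> degree J v = 1")
      case True
      then have "card A = 2" "Jv v \<subseteq> A" "card (Jv v) = 1" using S[of v] by (auto simp: A_def degJ)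
      then obtain x where x: "Jv v = {x}" "x \<in> A" by (auto simp: card_1_singleton_iff)
      have "card (A - {x}) = 1" using \<open>card A = 2\<close> x by simp
      then obtain y where "A - {x} = {y}" by (auto simp: card_1_singleton_iff)
      then have y: "A = {x, y}" "x \<noteq> y" using x by auto
      have "y \<in> N v" using y AB by auto
      then have yx: "x \<in> J" "y \<notin> J" using x y by (auto simp: Jv_def N_def)
      \<comment> \<open>Each colour occurs exactly once on the pair \<open>x\<close>,
        \<open>y\<close>, and only \<open>x\<close> is reversed, so both end up pointing the same
        way. Together with the split 3 + 3 of the other six edges this yields 3 + 5.\<close>
      have "a0 \<noteq> 0" "a1 \<noteq> 0" using a sums(1) \<open>card A = 2\<close> by simp_all
      then have "{e \<in> A. c (e, v) = 0} \<noteq> {}" "{e \<in> A. c (e, v) \<noteq> 0} \<noteq> {}"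
        unfolding a0_def a1_def by (metis card.empty)+
      then have "(c (x, v) = 0) \<noteq> (c (y, v) = 0)" using y(1) by auto
      then have "out x v = out y v" using yx by (auto simp: out_def)
      then have "{e \<in> A. out e v} = {} \<or> {e \<in> A. out e v} = A" using y by auto
      then have "card {e \<in> A. out e v} = 0 \<or> card {e \<in> A. out e v} = 2"
        using \<open>card A = 2\<close> by auto
      moreover have "card B = 6" using dsum \<open>card A = 2\<close> True by simp
      then have "b0 = 3" using b sums(2) by simp
      ultimately have "p = 3 \<or> p = 5" unfolding p outB by auto
      then have "2 * ((p + 2) div 3 + (q + 2) div 3) \<le> degree E v - 1"
        using pq True by (intro balanced_split_bound[OF pq d5]) auto
      then show ?thesis using True by simp
    next
      case False
      then have "A = Jv v" using S[of v] by (auto simp: A_def split: if_splits)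
      \<comment> \<open>Here \<open>A\<close> consists of reversed edges only, so on it outgoing
        means colour 1.\<close>
      then have "{e \<in> A. out e v} = {e \<in> A. c (e, v) \<noteq> 0}" by (auto simp: out_def Jv_def)
      then have "p = a1 + b0" using p outB by (simp add: a1_def)
      then have "q = a0 + b1" using pq sums dsum by simp
      have A6: "card A = 0" if "degree E v = 6" using J6[OF that] \<open>A = Jv v\<close> by (simp add: degJ)
      show ?thesis
      proof (cases "degree E v = 8")
        case True
        then have "degree J v \<noteq> 1" using False by blast
        then have "degree J v = 0" using J8[OF True] by linarith
        then have "card A = 0" using \<open>A = Jv v\<close> degJ[of v] by simp
        moreover from this have "card B = 8" using dsum True by simp
        ultimately have "p = 4" "q = 4"
          using \<open>p = a1 + b0\<close> \<open>q = a0 + b1\<close> a b sums by simp_all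
        then show ?thesis using True \<open>degree J v = 0\<close> by simp
      next
        case n8: False
        \<comment> \<open>Rounding up in two classes instead of one is what allows
          \<open>(d + 2) div 2\<close> rather than \<open>(d + 1) div 2\<close> in
          \<open>balanced_split_bound\<close>.\<close>
        have "(card A + 1) div 2 + (card B + 1) div 2 \<le> (card A + card B + 2) div 2" by presburger
        note le = this[unfolded dsum]
        have "p \<le> (degree E v + 2) div 2"
          using order_trans[OF add_mono[OF a(2) b(1)] le] by (simp add: \<open>p = a1 + b0\<close>)
        moreover have "q \<le> (degree E v + 2) div 2"
          using order_trans[OF add_mono[OF a(1) b(2)] le] by (simp add: \<open>q = a0 + b1\<close>)
        moreover have "p = 3" if "degree E v = 6"
        proof -
          have "card B = 6" using dsum A6[OF that] that by simp
          then show ?thesis using A6[OF that] \<open>p = a1 + b0\<close> a b sums by simp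
        qed
        ultimately have "2 * ((p + 2) div 3 + (q + 2) div 3) \<le> degree E v - 1"
          using n8 by (intro balanced_split_bound[OF pq d5]) simp_all
        then show ?thesis using n8 by simp
      qed
    qed
    then show "2 * ((card {e \<in> E. v \<in> e \<and> out e v} + 2) div 3
        + (card {e \<in> E. v \<in> e \<and> \<not> out e v} + 2) div 3)
        \<le> (if degree E v = 8 \<and> degree J v = 0 then 8 else degree E v - 1)"
      by (simp add: p_def q_def)
  qed
qed

section \<open>The set of edges to be reversed\<close>

text \<open>Only vertices of degree 6 and 8 restrict \<open>J\<close>. In an inclusion-maximal
  \<open>J\<close>, an edge at a vertex \<open>u\<close> of degree 8 missed by \<open>J\<close>
  could be added unless its other end \<open>v\<close> forbids it, and the last conclusion lists the
  two ways in which \<open>v\<close> can do so.\<close>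

lemma maximal_matching_at_degree_8:
  fixes E :: "'a set set"
  assumes fin: "finite E"
  obtains J where "J \<subseteq> E" "\<And>v. degree E v = 6 \<Longrightarrow> degree J v = 0"
    "\<And>v. degree E v = 8 \<Longrightarrow> degree J v \<le> 1"
    "\<And>u v. {u, v} \<in> E \<Longrightarrow> degree E u = 8 \<Longrightarrow> degree J u = 0 \<Longrightarrow>
      degree E v = 6 \<or> degree E v = 8 \<and> degree J v > 0"
proof -
  define P where "P J \<longleftrightarrow> J \<subseteq> E \<and> (\<forall>v. (degree E v = 6 \<longrightarrow> degree J v = 0) \<and>
    (degree E v = 8 \<longrightarrow> degree J v \<le> 1))" for J
  have "finite (Collect P)"
    using fin by (intro finite_subset[of "Collect P" "Pow E"]) (auto simp: P_def)
  moreover have "P {}" by (simp add: P_def degree_def)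
  ultimately obtain J where J: "P J" and max: "\<And>J'. P J' \<Longrightarrow> J \<subseteq> J' \<Longrightarrow> J = J'"
    using finite_has_maximal[of "Collect P"] by auto
  have finJ: "finite J" using J fin by (auto simp: P_def intro: finite_subset)
  have insert_deg: "degree (insert e J) w \<le> degree J w + (if w \<in> e then 1 else 0)" for e w
  proof -
    have "{f \<in> insert e J. w \<in> f} = (if w \<in> e then insert e {f \<in> J. w \<in> f} else {f \<in> J. w \<in> f})"
      by auto
    then show ?thesis using finJ by (simp add: degree_def card_insert_if)
  qed
  show ?thesis
  proof (rule that[of J])
    fix u v assume uv: "{u, v} \<in> E" "degree E u = 8" "degree J u = 0"
    show "degree E v = 6 \<or> degree E v = 8 \<and> degree J v > 0"
    proof (rule ccontr)
      assume nv: "\<not> (degree E v = 6 \<or> degree E v = 8 \<and> degree J v > 0)"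
      have "P (insert {u, v} J)"
        unfolding P_def
      proof (intro conjI allI impI)
        show "insert {u, v} J \<subseteq> E" using uv J by (auto simp: P_def)
      next
        fix w assume "degree E w = 6"
        then show "degree (insert {u, v} J) w = 0"
          using insert_deg[of "{u, v}" w] J nv uv by (auto simp: P_def split: if_splits)
      next
        fix w assume "degree E w = 8"
        then show "degree (insert {u, v} J) w \<le> 1"
          using insert_deg[of "{u, v}" w] J nv uv
          by (cases "w \<in> {u, v}") (fastforce simp: P_def split: if_splits)+
      qed
      then have "{u, v} \<in> J" using max[of "insert {u, v} J"] by auto
      moreover have "{f \<in> J. u \<in> f} = {}" using uv(3) finJ by (simp add: degree_def)
      ultimately show False by blast
    qed
  qed (use J in \<open>auto simp: P_def\<close>)
qed

section \<open>The strong majority colouring\<close>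

theorem theorem4:
  fixes V :: "'a set" and E :: "'a set set"
  assumes "simple_graph V E"
    and "min_degree V E \<ge> 5"
  shows "Maj' E \<le> 3 \<and> (\<exists>c. strong_majority_edge_colouring E {..<3::nat} c)"
proof -
  have finV: "finite V" and sub: "\<And>e. e \<in> E \<Longrightarrow> e \<subseteq> V" and edge: "\<And>e. e \<in> E \<Longrightarrow> card e = 2"
    using assms(1) by (auto simp: simple_graph_def)
  have fin: "finite E" using finV sub by (intro finite_subset[of E "Pow V"]) auto
  have d5: "degree E v \<ge> 5" if "e \<in> E" "v \<in> e" for e v
  proof -
    have "5 \<le> enat (degree E v)"
      using assms(2) sub[OF that(1)] that(2) by (auto simp: min_degree_def le_INF_iff)
    then show ?thesis by (simp add: numeral_eq_enat)
  qed
  obtain J where J: "J \<subseteq> E" "\<And>v. degree E v = 6 \<Longrightarrow> degree J v = 0"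
    "\<And>v. degree E v = 8 \<Longrightarrow> degree J v \<le> 1"
    and maxJ: "\<And>u v. {u, v} \<in> E \<Longrightarrow> degree E u = 8 \<Longrightarrow> degree J u = 0 \<Longrightarrow>
      degree E v = 6 \<or> degree E v = 8 \<and> degree J v > 0"
    using maximal_matching_at_degree_8[OF fin] by blast
  obtain out :: "'a set \<Rightarrow> 'a \<Rightarrow> bool"
    where ends: "\<And>e u v. e \<in> E \<Longrightarrow> u \<in> e \<Longrightarrow> v \<in> e \<Longrightarrow> u \<noteq> v \<Longrightarrow> out e u \<noteq> out e v"
      and out: "\<And>v. degree E v \<ge> 5 \<Longrightarrow>
      2 * ((card {e \<in> E. v \<in> e \<and> out e v} + 2) div 3 + (card {e \<in> E. v \<in> e \<and> \<not> out e v} + 2) div 3)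
        \<le> (if degree E v = 8 \<and> degree J v = 0 then 8 else degree E v - 1)"
    by (rule balanced_orientation[OF fin edge J], assumption, assumption, assumption, rule that)
  \<comment> \<open>\<open>t\<close> and \<open>h\<close> pick the tail and the head. By
    \<open>ends\<close> these are unique, so the fibres over a vertex are exactly its outgoing and
    its ingoing edges.\<close>
  define t where "t e = (SOME v. v \<in> e \<and> out e v)" for e
  define h where "h e = (SOME v. v \<in> e \<and> \<not> out e v)" for e
  have th: "t e \<in> e \<and> out e (t e)" "h e \<in> e \<and> \<not> out e (h e)" if e: "e \<in> E" for e
  proof -
    obtain u v where "e = {u, v}" "u \<noteq> v" using edge[OF e] by (auto simp: card_2_iff)
    then have "\<exists>v. v \<in> e \<and> out e v" "\<exists>v. v \<in> e \<and> \<not> out e v"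
      using ends[OF e, of u v] by auto
    from this[THEN someI_ex] show "t e \<in> e \<and> out e (t e)" "h e \<in> e \<and> \<not> out e (h e)"
      unfolding t_def h_def .
  qed
  have t: "t e = v \<longleftrightarrow> v \<in> e \<and> out e v" and h: "h e = v \<longleftrightarrow> v \<in> e \<and> \<not> out e v" if "e \<in> E" for e v
    using th[OF that] ends[OF that, of v "t e"] ends[OF that, of v "h e"] by auto
  obtain c :: "'a set \<Rightarrow> nat" where cE: "c \<in> E \<rightarrow> {..<3}"
    and ct: "\<And>x \<alpha>. card {e \<in> E. t e = x \<and> c e = \<alpha>} \<le> (card {e \<in> E. t e = x} + 3 - 1) div 3"
    and ch: "\<And>x \<alpha>. card {e \<in> E. h e = x \<and> c e = \<alpha>} \<le> (card {e \<in> E. h e = x} + 3 - 1) div 3"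
    by (rule equitable_colouring[OF fin, of 3 t h]) simp_all
  have colour: "2 * card {e \<in> E. v \<in> e \<and> c e = \<alpha>}
      \<le> (if degree E v = 8 \<and> degree J v = 0 then 8 else degree E v - 1)" if "degree E v \<ge> 5" for v \<alpha>
  proof -
    have "{e \<in> E. v \<in> e \<and> c e = \<alpha>} \<subseteq> {e \<in> E. t e = v \<and> c e = \<alpha>} \<union> {e \<in> E. h e = v \<and> c e = \<alpha>}"
      using t h by auto
    then have "card {e \<in> E. v \<in> e \<and> c e = \<alpha>}
        \<le> card ({e \<in> E. t e = v \<and> c e = \<alpha>} \<union> {e \<in> E. h e = v \<and> c e = \<alpha>})"
      using fin by (intro card_mono) auto
    also have "\<dots> \<le> card {e \<in> E. t e = v \<and> c e = \<alpha>} + card {e \<in> E. h e = v \<and> c e = \<alpha>}"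
      by (rule card_Un_le)
    also have "\<dots> \<le> (card {e \<in> E. t e = v} + 2) div 3 + (card {e \<in> E. h e = v} + 2) div 3"
      using ct[of v \<alpha>] ch[of v \<alpha>] by simp
    also have "{e \<in> E. t e = v} = {e \<in> E. v \<in> e \<and> out e v}" using t by auto
    also have "{e \<in> E. h e = v} = {e \<in> E. v \<in> e \<and> \<not> out e v}" using h by auto
    finally have "card {e \<in> E. v \<in> e \<and> c e = \<alpha>} \<le> (card {e \<in> E. v \<in> e \<and> out e v} + 2) div 3
        + (card {e \<in> E. v \<in> e \<and> \<not> out e v} + 2) div 3" .
    from mult_le_mono2[OF this, of 2] out[OF that] show ?thesis by (rule order_trans)
  qed
  have "2 * card {f \<in> adjacent_edges E e. c f = \<alpha>} \<le> card (adjacent_edges E e)" if e: "e \<in> E" for e \<alpha>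
  proof -
    obtain u v where uv: "e = {u, v}" "u \<noteq> v" using edge[OF e] by (auto simp: card_2_iff)
    \<comment> \<open>Simplicity of the graph keeps the other edges at \<open>u\<close> disjoint
      from those at \<open>v\<close>, so their numbers add up exactly.\<close>
    have both: "f = e" if "f \<in> E" "u \<in> f" "v \<in> f" for f
    proof -
      have "card f = 2" using that edge by simp
      moreover from this have "finite f" by (simp add: card_ge_0_finite)
      ultimately have "e = f" using that uv by (intro card_subset_eq) auto
      then show ?thesis by (rule sym)
    qed
    have adj: "adjacent_edges E e = ({f \<in> E. u \<in> f} - {e}) \<union> ({f \<in> E. v \<in> f} - {e})"
      using uv by (auto simp: adjacent_edges_def)
    have "({f \<in> E. u \<in> f} - {e}) \<inter> ({f \<in> E. v \<in> f} - {e}) = {}" using both by auto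
    then have size: "card (adjacent_edges E e) = (degree E u - 1) + (degree E v - 1)"
      unfolding adj using fin e uv by (simp add: card_Un_disjoint degree_def)
    \<comment> \<open>The edge \<open>e\<close> may be counted at both ends here. This does no harm,
      since \<open>colour\<close> bounds the counts with \<open>e\<close> included.\<close>
    have "{f \<in> adjacent_edges E e. c f = \<alpha>} \<subseteq> {f \<in> E. u \<in> f \<and> c f = \<alpha>} \<union> {f \<in> E. v \<in> f \<and> c f = \<alpha>}"
      unfolding adj by auto
    then have "card {f \<in> adjacent_edges E e. c f = \<alpha>}
        \<le> card ({f \<in> E. u \<in> f \<and> c f = \<alpha>} \<union> {f \<in> E. v \<in> f \<and> c f = \<alpha>})"
      using fin by (intro card_mono) auto
    also have "\<dots> \<le> card {f \<in> E. u \<in> f \<and> c f = \<alpha>} + card {f \<in> E. v \<in> f \<and> c f = \<alpha>}"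
      by (rule card_Un_le)
    finally have le: "card {f \<in> adjacent_edges E e. c f = \<alpha>}
      \<le> card {f \<in> E. u \<in> f \<and> c f = \<alpha>} + card {f \<in> E. v \<in> f \<and> c f = \<alpha>}" .
    have du: "degree E u \<ge> 5" and dv: "degree E v \<ge> 5" using d5[OF e] uv by auto
    note bounds = colour[OF du, of \<alpha>] colour[OF dv, of \<alpha>]
    consider "degree E u = 8" "degree J u = 0" | "degree E v = 8" "degree J v = 0"
      | "\<not> (degree E u = 8 \<and> degree J u = 0)" "\<not> (degree E v = 8 \<and> degree J v = 0)"
      by auto
    then show ?thesis
    proof cases
      \<comment> \<open>Twice the count at \<open>u\<close> may exceed \<open>degree E u - 1\<close>
        by one. At \<open>v\<close> the degree is even and twice the count is at most
        \<open>degree E v - 1\<close>, hence by parity at most \<open>degree E v - 2\<close>, which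
        compensates.\<close>
      case 1
      then have "degree E v = 6 \<or> degree E v = 8 \<and> degree J v > 0" using maxJ[of u v] e uv by blast
      then show ?thesis using bounds le size 1 by auto
    next
      case 2
      then have "degree E u = 6 \<or> degree E u = 8 \<and> degree J u > 0"
        using maxJ[of v u] e uv by (simp add: insert_commute)
      then show ?thesis using bounds le size 2 by auto
    next
      case 3
      then show ?thesis using bounds le size du dv by (simp only: if_False)
    qed
  qed
  then have strong: "strong_majority_edge_colouring E {..<3::nat} c"
    using cE by (simp add: strong_majority_edge_colouring_def)
  then have "Maj' E \<le> enat 3" unfolding Maj'_def by (intro Inf_lower) blast
  then show ?thesis using strong by (auto simp: numeral_eq_enat)
qed

end
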